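(* If $d=(d_1,\ldots,d_n)$ is the non-increasing degree sequence of some forest, then $\alpha^{\mathcal F}_{\max}(d)=a(d)$.
   Context: All graphs are finite, simple and undirected. $[n]=\{1,\ldots,n\}$. For a sequence $d$ of non-negative integers, $\mathcal{F}(d)$ is the set of all forests with degree sequence $d$. $\alpha(G)$ is the independence number of $G$, that is, the largest order of a set of pairwise non-adjacent vertices. $\alpha^{\mathcal F}_{\max}(d)=\max\{\alpha(F):F\in\mathcal{F}(d)\}$. For a non-increasing sequence $d=(d_1,\ldots,d_n)$, the annihilation number is $$a(d)=\max\Big\{a\in[n]:\sum_{i=n-a+1}^n d_i\le\sum_{i=1}^{n-a}d_i\Big\},$$ where empty sums are $0$. *)

theory Defs
  imports "Graph_Theory.Pair_Digraph"
begin

(* Finite simple undirected graphs are the symmetric loop-free digraphs of locale pair_graph,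
   so that an edge uv is the pair of arcs (u,v), (v,u), and the degree of v is its out-degree. *)

definition vertex_degree :: "'a pair_pre_digraph \<Rightarrow> 'a \<Rightarrow> nat" where
  "vertex_degree G v = out_degree (with_proj G) v"

(* The library predicate cycle also accepts the closed walk u, v, u along the two arcs of a
   single edge; the bound on the length leaves exactly the cycles of the undirected graph.
   For the same reason Digraph_Component.forest is not usable here: it only holds for
   symmetric digraphs without arcs. *)
definition undirected_forest :: "'a pair_pre_digraph \<Rightarrow> bool" where
  "undirected_forest G \<longleftrightarrow>
     pair_graph G \<and> \<not> (\<exists>p. pre_digraph.cycle (with_proj G) p \<and> length p \<ge> 3)"

definition has_degree_sequence :: "'a pair_pre_digraph \<Rightarrow> nat list \<Rightarrow> bool" where
  "has_degree_sequence G d \<longleftrightarrow>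
     (\<exists>vs. distinct vs \<and> set vs = pverts G \<and> map (vertex_degree G) vs = d)"

definition forests_with :: "nat list \<Rightarrow> 'a pair_pre_digraph set" where
  "forests_with d = {F. undirected_forest F \<and> has_degree_sequence F d}"

definition independent_set :: "'a pair_pre_digraph \<Rightarrow> 'a set \<Rightarrow> bool" where
  "independent_set G S \<longleftrightarrow> S \<subseteq> pverts G \<and> (\<forall>u\<in>S. \<forall>v\<in>S. (u, v) \<notin> parcs G)"

definition independence_number :: "'a pair_pre_digraph \<Rightarrow> nat" where
  "independence_number G = Max {card S | S. independent_set G S}"

(* The type argument is the type of the vertices. *)
definition alpha_forest_max :: "'a itself \<Rightarrow> nat list \<Rightarrow> nat" where
  "alpha_forest_max _ d =
     Max {independence_number F | F :: 'a pair_pre_digraph. F \<in> forests_with d}"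

(* The entry d_i of the sequence (d_1, ..., d_n) is d ! (i - 1). *)
definition annihilation_number :: "nat list \<Rightarrow> nat" where
  "annihilation_number d =
     (let n = length d in
      Max {a \<in> {1..n}. (\<Sum>i = n - a + 1..n. d ! (i - 1)) \<le> (\<Sum>i = 1..n - a. d ! (i - 1))})"

end

theory Submission
  imports Defs
begin

text \<open>
  An independent set of order \<open>k\<close> sends all its edges to the other vertices, so the \<open>k\<close> smallest
  degrees sum up to at most the remaining ones. Conversely, a forest in which a prescribed set \<open>S\<close>
  with \<open>\<Sum>\<^sub>S d \<le> \<Sum>\<^sub>V\<^sub>-\<^sub>S d\<close> is independent is built one edge at a time: some
  vertex \<open>u\<close> of required degree 1 can be joined to some vertex \<open>v\<close> of positive required degree so
  that the residual requirement (0 at \<open>u\<close>, one less at \<open>v\<close>) satisfies the same conditions, and a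
  forest realizing the residual requirement stays a forest when the pendant edge \<open>uv\<close> is added.
\<close>

section \<open>1-degenerate relations\<close>

text \<open>Acyclicity in the form of 1-degeneracy, which is visibly preserved by deleting edges and
  by adding a pendant edge.\<close>

definition degenerate1 :: "'a rel \<Rightarrow> bool" where
  "degenerate1 E \<longleftrightarrow> (\<forall>W. finite W \<longrightarrow> W \<noteq> {} \<longrightarrow> (\<exists>w\<in>W. card (E `` {w} \<inter> W) \<le> 1))"

lemma degenerate1D:
  assumes "degenerate1 E" "finite W" "W \<noteq> {}"
  obtains w where "w \<in> W" "card (E `` {w} \<inter> W) \<le> 1"
  using assms unfolding degenerate1_def by blast

lemma degenerate1_mono:
  assumes "degenerate1 E" "E' \<subseteq> E"
  shows "degenerate1 E'"
  unfolding degenerate1_def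
proof (intro allI impI)
  fix W :: "'a set" assume W: "finite W" "W \<noteq> {}"
  then obtain w where w: "w \<in> W" "card (E `` {w} \<inter> W) \<le> 1"
    using assms(1) by (blast elim: degenerate1D)
  have "card (E' `` {w} \<inter> W) \<le> card (E `` {w} \<inter> W)"
    using W assms(2) by (intro card_mono) auto
  with w show "\<exists>w\<in>W. card (E' `` {w} \<inter> W) \<le> 1" by force
qed

text \<open>If \<open>u\<close> lies in \<open>W\<close>, then \<open>u\<close> is the required
  vertex, since its only neighbour is \<open>v\<close>; otherwise the new edge contributes nothing
  inside \<open>W\<close>.\<close>

lemma degenerate1_insert_pendant:
  assumes "degenerate1 E" "u \<notin> Field E" "u \<noteq> v"
  shows "degenerate1 (insert (u, v) (insert (v, u) E))"
  unfolding degenerate1_def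
proof (intro allI impI)
  let ?E = "insert (u, v) (insert (v, u) E)"
  fix W :: "'a set" assume W: "finite W" "W \<noteq> {}"
  show "\<exists>w\<in>W. card (?E `` {w} \<inter> W) \<le> 1"
  proof (cases "u \<in> W")
    case True
    have "?E `` {u} \<inter> W \<subseteq> {v}"
      using assms(2,3) by (auto simp: Field_def)
    then have "card (?E `` {u} \<inter> W) \<le> card {v}"
      by (intro card_mono) auto
    with True show ?thesis by auto
  next
    case False
    obtain w where w: "w \<in> W" "card (E `` {w} \<inter> W) \<le> 1"
      using assms(1) W by (blast elim: degenerate1D)
    have "?E `` {w} \<inter> W = E `` {w} \<inter> W"
      using False w(1) by auto
    with w show ?thesis by (intro bexI[of _ w]) simp_all
  qed
qed

section \<open>Forests in terms of cycles and of 1-degeneracy\<close>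

lemma vertex_degree_eq: "vertex_degree G v = card (parcs G `` {v})"
proof -
  have "out_arcs (with_proj G) v = Pair v ` (parcs G `` {v})"
    by (auto simp: out_arcs_def)
  then show ?thesis
    by (simp add: vertex_degree_def out_degree_def card_image inj_on_def)
qed

lemma pcas_nth:
  assumes "pcas u p v" "Suc i < length p"
  shows "snd (p ! i) = fst (p ! Suc i)"
  using assms
proof (induction u p v arbitrary: i rule: pcas.induct)
  case (2 u e es v)
  then show ?case by (cases i; cases es) auto
qed simp

lemma pcas_ends:
  assumes "pcas u p v" "p \<noteq> []"
  shows "fst (p ! 0) = u" "snd (p ! (length p - 1)) = v"
proof -
  have "p \<noteq> [] \<longrightarrow> fst (p ! 0) = u \<and> snd (p ! (length p - 1)) = v"
    using assms(1)
  proof (induction u p v rule: pcas.induct)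
    case (2 u e es v)
    then show ?case by (cases es) auto
  qed simp
  with assms(2) show "fst (p ! 0) = u" "snd (p ! (length p - 1)) = v" by auto
qed

text \<open>Turns the distinctness condition in \<open>cycle\<close> into distinctness of the heads
  of the arcs, which can be addressed by index.\<close>

lemma tl_pawalk_verts: "pcas u p v \<Longrightarrow> tl (pawalk_verts u p) = map snd p"
proof (induction u p v rule: pcas.induct)
  case (2 u e es v)
  then show ?case by (cases es) auto
qed simp

text \<open>On the vertex set of a cycle of length at least 3, every vertex has two distinct
  neighbours, its predecessor and its successor.\<close>

lemma degenerate1_no_cycle:
  assumes "pair_graph G" "degenerate1 (parcs G)"
    and "pre_digraph.cycle (with_proj G) p" "length p \<ge> 3"
  shows False
proof -
  interpret pair_graph G by fact
  obtain u where u: "awalk u p u" "distinct (tl (pawalk_verts u p))" "p \<noteq> []"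
    using assms(3) unfolding cycle_def by auto
  have cas: "pcas u p u" and sub: "set p \<subseteq> parcs G" using u(1) by auto
  let ?n = "length p"
  let ?W = "snd ` set p"
  have dist: "distinct (map snd p)" using u(2) tl_pawalk_verts[OF cas] by simp
  have step: "snd (p ! i) = fst (p ! (Suc i mod ?n))" if "i < ?n" for i
  proof (cases "Suc i < ?n")
    case True
    then show ?thesis using pcas_nth[OF cas] by simp
  next
    case False
    with that have "i = ?n - 1" "Suc i = ?n" by auto
    then show ?thesis using pcas_ends[OF cas u(3)] by auto
  qed
  have "finite ?W" "?W \<noteq> {}" using u(3) by auto
  then obtain w where w: "w \<in> ?W" "card (parcs G `` {w} \<inter> ?W) \<le> 1"
    using assms(2) by (blast elim: degenerate1D)
  then obtain j where j: "j < ?n" "snd (p ! j) = w"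
    by (auto simp: in_set_conv_nth)
  \<comment> \<open>The cyclic predecessor and successor of position \<open>j\<close>; they differ
    because the length is at least 3.\<close>
  define i where "i = (if j = 0 then ?n - 1 else j - 1)"
  define k where "k = Suc j mod ?n"
  have i: "i < ?n" "Suc i mod ?n = j" and k: "k < ?n" and "i \<noteq> k"
    using j(1) assms(4) by (auto simp: i_def k_def mod_Suc)
  then have ne: "snd (p ! i) \<noteq> snd (p ! k)"
    using dist by (auto simp: distinct_conv_nth)
  have "(snd (p ! i), w) \<in> parcs G"
    using step[OF i(1)] i(2) j sub nth_mem by fastforce
  then have "(w, snd (p ! i)) \<in> parcs G" by (rule arcs_symmetric)
  moreover have "(w, snd (p ! k)) \<in> parcs G"
    using step[OF j(1)] k j(2) sub nth_mem unfolding k_def by fastforce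
  ultimately have "{snd (p ! i), snd (p ! k)} \<subseteq> parcs G `` {w} \<inter> ?W"
    using i k by auto
  then have "card {snd (p ! i), snd (p ! k)} \<le> card (parcs G `` {w} \<inter> ?W)"
    by (intro card_mono) auto
  with ne w(2) show False by simp
qed

text \<open>In a set \<open>W\<close> of minimum inner degree 2, take a longest path. Its first
  vertex has a neighbour in \<open>W\<close> other than the second vertex; by maximality this
  neighbour lies on the path and closes a cycle.\<close>

lemma undirected_forest_degenerate1:
  assumes "undirected_forest G"
  shows "degenerate1 (parcs G)"
proof (rule ccontr)
  interpret pair_graph G using assms by (simp add: undirected_forest_def)
  assume "\<not> degenerate1 (parcs G)"
  then obtain W where W: "finite W" "W \<noteq> {}"
    and two: "\<And>w. w \<in> W \<Longrightarrow> card (parcs G `` {w} \<inter> W) \<ge> 2"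
    unfolding degenerate1_def by (metis Suc_1 not_less_eq_eq)
  have other: "\<exists>y\<in>W. (w, y) \<in> parcs G \<and> y \<noteq> z" if "w \<in> W" for w z
  proof (rule ccontr)
    assume "\<not> ?thesis"
    then have "parcs G `` {w} \<inter> W \<subseteq> {z}" by auto
    then have "card (parcs G `` {w} \<inter> W) \<le> card {z}" by (intro card_mono) auto
    with two[OF that] show False by simp
  qed
  define P where "P p \<longleftrightarrow> (\<exists>u v. apath u p v \<and> set (pawalk_verts u p) \<subseteq> W)" for p
  have "P p \<Longrightarrow> length p < Suc (card W)" for p
  proof -
    assume "P p"
    then obtain u v where "apath u p v" "set (pawalk_verts u p) \<subseteq> W"
      unfolding P_def by blast
    then have "length (pawalk_verts u p) \<le> card W"
      using W(1) by (metis apath_def card_mono distinct_card)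
    then show "length p < Suc (card W)"
      using length_awalk_verts[of u p] by simp
  qed
  moreover obtain w0 where "w0 \<in> W" using W by auto
  moreover have "w0 \<in> pverts G" using other[OF \<open>w0 \<in> W\<close>] by (blast dest: wellformed')
  ultimately have ex: "P []" "\<forall>p. P p \<longrightarrow> length p < Suc (card W)"
    unfolding P_def by (auto simp: apath_Nil_iff)
  then obtain p where p: "P p" "\<And>q. P q \<Longrightarrow> length q \<le> length p"
    using ex_has_greatest_nat[of P "[]" length "Suc (card W)"] by auto
  then obtain u v where path: "apath u p v" "set (pawalk_verts u p) \<subseteq> W"
    unfolding P_def by blast
  have "u \<in> W" using path hd_in_awalk_verts(2) by blast
  \<comment> \<open>\<open>snd (hd p)\<close> is the second vertex of the path. For
    \<open>p = []\<close> it is an arbitrary value, which is harmless because \<open>other\<close>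
    allows any vertex to be excluded.\<close>
  then obtain y where y: "y \<in> W" "(u, y) \<in> parcs G" "y \<noteq> snd (hd p)" using other by blast
  have yu: "(y, u) \<in> parcs G" using y(2) by (rule arcs_symmetric)
  have "y \<in> set (pawalk_verts u p)"
  proof (rule ccontr)
    assume "y \<notin> set (pawalk_verts u p)"
    then have "P ((y, u) # p)"
      unfolding P_def using path y(1) yu
      by (intro exI[of _ y] exI[of _ v]) (auto simp: apath_Cons_iff)
    with p(2) show False by fastforce
  qed
  then obtain q r where qr: "p = q @ r" "awalk u q y"
    using path(1) awalk_decomp[of u p v y] unfolding apath_def by blast
  \<comment> \<open>The initial part \<open>q\<close> of the path is not empty since there are no
    loops, and not a single arc since \<open>y\<close> is not the second vertex. So
    \<open>(y, u) # q\<close> has length at least 3.\<close>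
  have "q \<noteq> []" using qr(2) y(2) no_loops' by (auto simp: awalk_Nil_iff)
  moreover have "q \<noteq> [e]" for e using qr y(3) by (auto simp: awalk_simps)
  ultimately have len: "length q \<ge> 2" by (cases q; cases "tl q") auto
  have "distinct (pawalk_verts u p)" using path(1) unfolding apath_def by simp
  then have "distinct (pawalk_verts u q)"
    using path(1) awalk_verts_append[of u q r v] unfolding qr(1) apath_def by simp
  then have "cycle ((y, u) # q)"
    unfolding cycle_def using qr(2) yu
    by (intro exI[of _ y]) (auto simp: awalk_Cons_iff)
  with len assms show False unfolding undirected_forest_def by fastforce
qed

section \<open>Degree sums and realization by forests\<close>

text \<open>Records how deleting the edge \<open>uv\<close> changes degree sums; the additive form
  avoids truncated subtraction outside the function update.\<close>

lemma sum_eq_sum_decrement_pair: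
  fixes f :: "'a \<Rightarrow> nat"
  assumes "finite X" "u \<noteq> v" "f u \<ge> 1" "f v \<ge> 1"
  shows "sum f X = sum (f(u := f u - 1, v := f v - 1)) X + of_bool (u \<in> X) + of_bool (v \<in> X)"
proof -
  have "f = (\<lambda>x. (f(u := f u - 1, v := f v - 1)) x + of_bool (x = u) + of_bool (x = v))"
    using assms by auto
  then have "sum f X = (\<Sum>x\<in>X. (f(u := f u - 1, v := f v - 1)) x + of_bool (x = u) + of_bool (x = v))"
    by presburger
  also have "\<dots> = sum (f(u := f u - 1, v := f v - 1)) X + of_bool (u \<in> X) + of_bool (v \<in> X)"
    using assms(1) by (simp add: sum.distrib of_bool_def sum.delta del: fun_upd_apply)
  finally show ?thesis .
qed

text \<open>Twice the bound that a forest with edges has fewer edges than non-isolated vertices.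
  Deleting a pendant edge lowers the degree sum by 2 and the number of non-isolated vertices by at
  least 1.\<close>

lemma forest_degree_sum:
  assumes "finite V" "E \<subseteq> V \<times> V" "sym E" "irrefl E" "degenerate1 E"
  shows "even (\<Sum>v\<in>V. card (E `` {v})) \<and>
    (E \<noteq> {} \<longrightarrow> (\<Sum>v\<in>V. card (E `` {v})) + 2 \<le> 2 * card {v \<in> V. card (E `` {v}) \<noteq> 0})"
  using assms(2-)
proof (induction "card E" arbitrary: E rule: less_induct)
  case less
  have fin: "finite E" using less.prems(1) assms(1) by (meson finite_SigmaI finite_subset)
  have finI: "finite (E `` {v})" for v using fin by (simp add: finite_Image)
  show ?case
  proof (cases "E = {}")
    case False
    have "finite (fst ` E)" "fst ` E \<noteq> {}" using fin False by auto
    then obtain u where u: "u \<in> fst ` E" "card (E `` {u} \<inter> fst ` E) \<le> 1"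
      using less.prems(4) by (blast elim: degenerate1D)
    \<comment> \<open>Degeneracy was applied to the non-isolated vertices. By symmetry they contain
      all neighbours of \<open>u\<close>, so \<open>u\<close> has degree 1 in the whole of
      \<open>E\<close>.\<close>
    have "E `` {u} \<inter> fst ` E = E `` {u}" using less.prems(2) by (force dest: symD)
    moreover have "E `` {u} \<noteq> {}" using u(1) by force
    ultimately have "card (E `` {u}) = 1"
      using u(2) finI[of u] by (metis One_nat_def Suc_leI card_gt_0_iff le_antisym)
    then obtain v where v: "E `` {u} = {v}" by (auto simp: card_1_singleton_iff)
    then have uv: "(u, v) \<in> E" "(v, u) \<in> E" using less.prems(2) by (auto dest: symD)
    then have ne: "u \<noteq> v" and V: "u \<in> V" "v \<in> V"
      using less.prems(1,3) by (auto simp: irrefl_def)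
    define E' where "E' = E - {(u, v), (v, u)}"
    define f where "f x = card (E `` {x})" for x
    define f' where "f' x = card (E' `` {x})" for x
    have "E' `` {u} = {}" "E' `` {v} = E `` {v} - {u}" using v ne unfolding E'_def by auto
    moreover have "E' `` {x} = E `` {x}" if "x \<noteq> u" "x \<noteq> v" for x
      using that unfolding E'_def by auto
    moreover have "f u = 1" "f v \<ge> 1"
      using v uv finI[of v] by (auto simp: f_def card_gt_0_iff Suc_le_eq)
    moreover have "u \<in> E `` {v}" using uv by auto
    ultimately have f': "f' = f(u := f u - 1, v := f v - 1)"
      using ne finI[of v] by (auto simp: f'_def f_def fun_eq_iff card_Diff_singleton)
    have sum: "sum f V = sum f' V + 2"
      unfolding f' using sum_eq_sum_decrement_pair[of V u v f] assms(1) ne V \<open>f u = 1\<close> \<open>f v \<ge> 1\<close>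
      by simp
    have "card E' < card E" unfolding E'_def using fin uv by (intro psubset_card_mono) auto
    moreover have "E' \<subseteq> V \<times> V" "sym E'" "irrefl E'" "degenerate1 E'"
      using less.prems degenerate1_mono[of E E'] unfolding E'_def
      by (auto simp: sym_def irrefl_def)
    ultimately have IH: "even (sum f' V)"
      "E' \<noteq> {} \<Longrightarrow> sum f' V + 2 \<le> 2 * card {v \<in> V. f' v \<noteq> 0}"
      using less.hyps[of E'] unfolding f'_def by auto
    have sub: "insert u {v \<in> V. f' v \<noteq> 0} \<subseteq> {v \<in> V. f v \<noteq> 0}"
      using V \<open>f u = 1\<close> \<open>f v \<ge> 1\<close> ne by (auto simp: f')
    have "u \<notin> {v \<in> V. f' v \<noteq> 0}" using \<open>f u = 1\<close> ne by (simp add: f')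
    then have card: "card {v \<in> V. f' v \<noteq> 0} + 1 \<le> card {v \<in> V. f v \<noteq> 0}"
      using card_mono[OF _ sub] assms(1) by simp
    have "sum f V + 2 \<le> 2 * card {v \<in> V. f v \<noteq> 0}"
    \<comment> \<open>For a single edge the induction hypothesis gives no inequality, so both sides
      are computed directly.\<close>
    proof (cases "E' = {}")
      case True
      then have "sum f V = 2" using sum by (simp add: f'_def)
      moreover have "{u, v} \<subseteq> {v \<in> V. f v \<noteq> 0}" using V \<open>f u = 1\<close> \<open>f v \<ge> 1\<close> by auto
      then have "card {u, v} \<le> card {v \<in> V. f v \<noteq> 0}" using assms(1) by (intro card_mono) auto
      ultimately show ?thesis using ne by simp
    next
      case False
      then show ?thesis using IH(2) sum card by simp
    qed
    then show ?thesis using IH(1) sum by (simp add: f_def)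
  qed simp
qed

text \<open>Induction on the degree sum, removing the requirements of one edge \<open>uv\<close>
  with \<open>f u = 1\<close>. The inequality in the last hypothesis fails for \<open>f = 0\<close>;
  the disjunct \<open>f v \<le> 1\<close> covers the end of the induction, where a matching
  remains.\<close>

lemma forest_realization_with_independent_set:
  fixes f :: "'a \<Rightarrow> nat"
  assumes "finite V" "S \<subseteq> V" "sum f S \<le> sum f (V - S)" "even (sum f V)"
    and "(\<forall>v\<in>V. f v \<le> 1) \<or> sum f V + 2 \<le> 2 * card {v \<in> V. f v \<noteq> 0}"
  shows "\<exists>E \<subseteq> V \<times> V. sym E \<and> irrefl E \<and> degenerate1 E \<and>
    (\<forall>v\<in>V. card (E `` {v}) = f v) \<and> E \<inter> S \<times> S = {}"
  using assms(3-)
proof (induction "sum f V" arbitrary: f rule: less_induct)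
  case less
  have finS: "finite S" using assms(1,2) finite_subset by auto
  show ?case
  proof (cases "sum f V = 0")
    case True
    then have "\<forall>v\<in>V. f v = 0" using assms(1) by simp
    then show ?thesis
      by (intro exI[of _ "{}"]) (auto simp: sym_def irrefl_def degenerate1_def)
  next
    case False
    \<comment> \<open>If no requirement were 1, every positive one would be at least 2, making the
      sum at least twice the number of positive requirements.\<close>
    have leaf: "\<exists>u\<in>V. f u = 1"
    proof (rule ccontr)
      assume no: "\<not> ?thesis"
      have "\<not> (\<forall>v\<in>V. f v \<le> 1)"
      proof
        assume le: "\<forall>v\<in>V. f v \<le> 1"
        obtain v where "v \<in> V" "f v \<noteq> 0" using False by (meson sum.neutral)
        with le no show False by (metis le_antisym less_one not_le)
      qed
      then have bd: "sum f V + 2 \<le> 2 * card {v \<in> V. f v \<noteq> 0}" using less.prems(3) by blast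
      have "2 * card {v \<in> V. f v \<noteq> 0} = (\<Sum>v \<in> {v \<in> V. f v \<noteq> 0}. 2)" by simp
      also have "\<dots> \<le> (\<Sum>v \<in> {v \<in> V. f v \<noteq> 0}. f v)"
      proof (rule sum_mono)
        fix v assume "v \<in> {v \<in> V. f v \<noteq> 0}"
        then have "f v \<noteq> 0" "f v \<noteq> 1" using no by auto
        then show "2 \<le> f v" by simp
      qed
      also have "\<dots> \<le> sum f V" using assms(1) by (intro sum_mono2) auto
      finally show False using bd by simp
    qed
    \<comment> \<open>The last three conditions serve in turn to keep \<open>S\<close> independent,
      to keep the sum over \<open>S\<close> at most that over \<open>V - S\<close>, and to keep the
      final disjunction true.\<close>
    have pick: "\<exists>u\<in>V. \<exists>v\<in>V. u \<noteq> v \<and> f u = 1 \<and> f v \<ge> 1 \<and> (u \<notin> S \<or> v \<notin> S)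
      \<and> (u \<in> S \<or> v \<in> S \<or> sum f S = 0) \<and> (f v \<ge> 2 \<or> (\<forall>v\<in>V. f v \<le> 1))"
    proof -
      \<comment> \<open>In (a), (b) and (d) the edge crosses between \<open>S\<close> and its
        complement. Case (c) is contradictory, and in (e) the requirements on \<open>S\<close> are
        exhausted, so the edge may lie outside \<open>S\<close>.\<close>
      consider (a) u v where "u \<in> V - S" "f u = 1" "v \<in> S" "f v \<ge> 2"
        | (b) u v where "u \<in> S" "f u = 1" "v \<in> V - S" "f v \<ge> 2"
        | (c) "\<not> (\<exists>u\<in>V - S. f u = 1)" "\<exists>u\<in>S. f u = 1" "\<forall>v\<in>V - S. f v \<le> 1"
        | (d) "\<forall>v\<in>S. f v \<le> 1" "\<exists>u\<in>S. f u = 1" "\<exists>u\<in>V - S. f u = 1" "\<forall>v\<in>V - S. f v \<le> 1"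
        | (e) "\<forall>v\<in>S. f v = 0" "\<exists>u\<in>V - S. f u = 1"
      proof -
        have two: "f v \<ge> 2 \<longleftrightarrow> \<not> f v \<le> 1" for v by auto
        have zero: "f v = 0 \<longleftrightarrow> f v \<le> 1 \<and> f v \<noteq> 1" for v by auto
        show ?thesis using leaf that assms(2) unfolding two zero by blast
      qed
      then show ?thesis
      proof cases
        case c
        then have "\<forall>v\<in>V - S. f v = 0" by (metis le_antisym less_one not_le)
        then have "sum f S = 0" using less.prems(1) by simp
        then show ?thesis using c(2) finS by auto
      next
        case d
        then show ?thesis using assms(2) by (metis Diff_iff le_refl subsetD)
      next
        case e
        then obtain u where u: "u \<in> V - S" "f u = 1" by blast
        have z: "sum f S = 0" using e by simp
        show ?thesis
        proof (cases "\<exists>v\<in>V. f v \<ge> 2")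
          case True
          then obtain v where v: "v \<in> V" "f v \<ge> 2" by blast
          then have "v \<notin> S" "u \<noteq> v" using e u by auto
          then show ?thesis using u v z by (intro bexI[of _ u] bexI[of _ v]) auto
        next
          case False
          then have le: "\<forall>v\<in>V. f v \<le> 1" by force
          \<comment> \<open>Parity: if \<open>u\<close> alone had a positive requirement, the total
            would be 1.\<close>
          have "\<exists>v\<in>V. v \<noteq> u \<and> f v \<noteq> 0"
          proof (rule ccontr)
            assume "\<not> ?thesis"
            then have "sum f V = (\<Sum>x\<in>V. if x = u then 1 else 0)"
              using u by (intro sum.cong) auto
            then have "sum f V = 1" using u assms(1) by simp
            with less.prems(2) show False by simp
          qed
          then obtain v where v: "v \<in> V" "v \<noteq> u" "f v \<noteq> 0" by blast
          then have "v \<notin> S" using e by auto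
          then show ?thesis using u v z le by (intro bexI[of _ u] bexI[of _ v]) auto
        qed
      qed (use assms(2) in force)+
    qed
    then obtain u v where V: "u \<in> V" "v \<in> V" and ne: "u \<noteq> v" and f1: "f u = 1" "f v \<ge> 1"
      and S1: "u \<notin> S \<or> v \<notin> S" and S2: "u \<in> S \<or> v \<in> S \<or> sum f S = 0"
      and big: "f v \<ge> 2 \<or> (\<forall>v\<in>V. f v \<le> 1)" by blast
    define f' where "f' = f(u := f u - 1, v := f v - 1)"
    have f'_simps: "f' u = 0" "f' v = f v - 1" "\<And>x. x \<noteq> u \<Longrightarrow> x \<noteq> v \<Longrightarrow> f' x = f x"
      using ne f1 by (auto simp: f'_def)
    have sums: "finite X \<Longrightarrow> sum f X = sum f' X + of_bool (u \<in> X) + of_bool (v \<in> X)" for X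
      using sum_eq_sum_decrement_pair[of X u v f] ne f1 by (simp add: f'_def)
    have sumV: "sum f V = sum f' V + 2" using sums[of V] assms(1) V by simp
    have even': "even (sum f' V)" using sumV less.prems(2) by simp
    \<comment> \<open>A crossing edge lowers both sides by 1; otherwise the left side is 0.\<close>
    have le': "sum f' S \<le> sum f' (V - S)"
    proof (cases "u \<in> S \<or> v \<in> S")
      case True
      then show ?thesis using sums[of S] sums[of "V - S"] finS assms(1) V S1 less.prems(1)
        by (auto simp: of_bool_def)
    next
      case False
      then show ?thesis using S2 sums[of S] finS by simp
    qed
    have cond': "(\<forall>v\<in>V. f' v \<le> 1) \<or> sum f' V + 2 \<le> 2 * card {v \<in> V. f' v \<noteq> 0}"
    proof (cases "\<forall>v\<in>V. f v \<le> 1")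
      case True
      then have "\<forall>v\<in>V. f' v \<le> 1" using ne by (auto simp: f'_def)
      then show ?thesis by blast
    next
      case False
      then have "f v \<ge> 2" and bd: "sum f V + 2 \<le> 2 * card {v \<in> V. f v \<noteq> 0}"
        using big less.prems(3) by auto
      \<comment> \<open>Since \<open>f v \<ge> 2\<close>, only \<open>u\<close> drops out of the
        support, and both sides of the inequality fall by exactly 2.\<close>
      then have "{v \<in> V. f v \<noteq> 0} = insert u {v \<in> V. f' v \<noteq> 0}"
        using V f1 ne by (auto simp: f'_def)
      then have "card {v \<in> V. f v \<noteq> 0} = Suc (card {v \<in> V. f' v \<noteq> 0})"
        using assms(1) f'_simps(1) by simp
      then show ?thesis using bd sumV by simp
    qed
    obtain E where E: "E \<subseteq> V \<times> V" "sym E" "irrefl E" "degenerate1 E"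
      and deg: "\<forall>v\<in>V. card (E `` {v}) = f' v" and ind: "E \<inter> S \<times> S = {}"
      using less.hyps[of f'] sumV le' even' cond' by auto
    have finI: "finite (E `` {x})" for x
      using E(1) assms(1) by (meson finite_Image finite_SigmaI finite_subset)
    have "E `` {u} = {}" using deg V(1) f'_simps(1) finI[of u] by (metis card_0_eq)
    then have uF: "u \<notin> Field E" using E(2) by (auto simp: Field_def dest: symD)
    let ?E = "insert (u, v) (insert (v, u) E)"
    have "card (?E `` {x}) = f x" if "x \<in> V" for x
    proof -
      consider "x = u" | "x = v" | "x \<noteq> u" "x \<noteq> v" by blast
      then show ?thesis
      proof cases
        case 1
        then have "?E `` {x} = {v}" using \<open>E `` {u} = {}\<close> ne by auto
        then show ?thesis using 1 f1 by simp
      next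
        case 2
        then have "?E `` {x} = insert u (E `` {v})" using ne by auto
        moreover have "u \<notin> E `` {v}" using uF by (auto simp: Field_def)
        ultimately show ?thesis using 2 f1 V deg f'_simps(2) finI[of v] by simp
      next
        case 3
        then have "?E `` {x} = E `` {x}" by auto
        then show ?thesis using 3 deg that f'_simps(3) by simp
      qed
    qed
    moreover have "?E \<subseteq> V \<times> V" "sym ?E" "irrefl ?E" using E V ne by (auto simp: sym_def irrefl_def)
    moreover have "degenerate1 ?E" by (rule degenerate1_insert_pendant[OF E(4) uF ne])
    moreover have "?E \<inter> S \<times> S = {}" using ind S1 by auto
    ultimately show ?thesis by blast
  qed
qed

section \<open>Independent sets and the annihilation number\<close>

text \<open>Reversing arcs injects the arcs leaving \<open>S\<close> into those leaving
  \<open>V - S\<close>.\<close>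

lemma independent_degree_sum_le:
  assumes "finite V" "E \<subseteq> V \<times> V" "sym E" "S \<subseteq> V" "E \<inter> S \<times> S = {}"
  shows "(\<Sum>v\<in>S. card (E `` {v})) \<le> (\<Sum>v\<in>V - S. card (E `` {v}))"
proof -
  have finI: "finite (E `` {x})" for x
    using assms(1,2) by (meson finite_Image finite_SigmaI finite_subset)
  have "(\<Sum>v\<in>S. card (E `` {v})) = card (SIGMA v:S. E `` {v})"
    using assms(1,4) finI by (subst card_SigmaI) (auto intro: finite_subset)
  also have "\<dots> = card (prod.swap ` (SIGMA v:S. E `` {v}))"
    by (simp add: card_image)
  also have "\<dots> \<le> card (SIGMA v:V - S. E `` {v})"
    using assms finI by (intro card_mono) (auto dest: symD)
  also have "\<dots> = (\<Sum>v\<in>V - S. card (E `` {v}))"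
    using assms(1) finI by (subst card_SigmaI) auto
  finally show ?thesis .
qed

text \<open>Exchange argument: the final segment \<open>?J\<close> and \<open>I\<close> have equally
  large differences, and \<open>g (n - card I)\<close> bounds \<open>g\<close> from above on
  \<open>?J - I\<close> and from below on \<open>I - ?J\<close>.\<close>

lemma sum_final_segment_le:
  fixes g :: "nat \<Rightarrow> nat"
  assumes anti: "\<And>i j. i \<le> j \<Longrightarrow> j < n \<Longrightarrow> g j \<le> g i" and "I \<subseteq> {..<n}"
  shows "sum g {n - card I..<n} \<le> sum g I"
proof -
  let ?J = "{n - card I..<n}"
  have fin: "finite I" and le: "card I \<le> n"
    using assms(2) finite_subset card_mono[of "{..<n}" I] by auto
  have card: "card (?J - I) = card (I - ?J)"
    using fin le by (simp add: card_Diff_subset_Int Int_commute)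
  have "sum g (?J - I) \<le> sum g (I - ?J)"
  proof (cases "?J - I = {}")
    case False
    then have k: "card I > 0" "n - card I < n" using fin by (auto simp: card_gt_0_iff)
    have "sum g (?J - I) \<le> card (?J - I) * g (n - card I)"
      using sum_bounded_above[of "?J - I" g "g (n - card I)"] anti by simp
    also have "\<dots> = card (I - ?J) * g (n - card I)" using card by simp
    also have "\<dots> \<le> sum g (I - ?J)"
      using sum_bounded_below[of "I - ?J" "g (n - card I)" g] anti assms(2) k(2) by force
    finally show ?thesis .
  next
    case True
    then show ?thesis by (simp only: sum.empty)
  qed
  then have "sum g (?J - I) + sum g (?J \<inter> I) \<le> sum g (I - ?J) + sum g (?J \<inter> I)" by simp
  then show ?thesis
    using sum.Int_Diff[of ?J g I] sum.Int_Diff[of I g ?J] fin by (simp add: Int_commute)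
qed

lemma annihilation_number_eq:
  "annihilation_number d = Max {a \<in> {1..length d}.
     sum ((!) d) {length d - a..<length d} \<le> sum ((!) d) {..<length d - a}}"
proof -
  have "(\<Sum>i = m + 1..n. d ! (i - 1)) = sum ((!) d) {m..<n}" for m n
    by (rule sum.reindex_bij_witness[of _ Suc "\<lambda>i. i - 1"]) auto
  moreover have "(\<Sum>i = 1..n. d ! (i - 1)) = sum ((!) d) {..<n}" for n
    by (rule sum.reindex_bij_witness[of _ Suc "\<lambda>i. i - 1"]) auto
  ultimately show ?thesis unfolding annihilation_number_def Let_def by simp
qed

text \<open>The upper bound: the degrees on \<open>S\<close> sum to at most half of the total, hence
  so do the \<open>card S\<close> last, that is smallest, entries of \<open>d\<close>.\<close>

lemma independent_set_annihilates:
  assumes "pair_graph G" "has_degree_sequence G d" "sorted_wrt (\<ge>) d" "independent_set G S"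
  shows "card S \<le> length d"
    and "sum ((!) d) {length d - card S..<length d} \<le> sum ((!) d) {..<length d - card S}"
proof -
  interpret pair_graph G by fact
  obtain vs where vs: "distinct vs" "set vs = pverts G" "map (vertex_degree G) vs = d"
    using assms(2) unfolding has_degree_sequence_def by blast
  let ?n = "length d"
  have len: "length vs = ?n" using vs(3) by auto
  \<comment> \<open>The positions of \<open>S\<close> in the enumeration \<open>vs\<close>; they
    need not form a final segment.\<close>
  define I where "I = {i \<in> {..<?n}. vs ! i \<in> S}"
  have S: "S \<subseteq> set vs" "parcs G \<inter> S \<times> S = {}"
    using assms(4) vs(2) unfolding independent_set_def by auto
  have bij: "bij_betw ((!) vs) {..<?n} (set vs)"
    using bij_betw_nth[OF vs(1)] len by simp
  have bijI: "bij_betw ((!) vs) I S"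
    using bij_betw_subset[OF bij, of I] S(1) len
    by (force simp: I_def in_set_conv_nth image_def bij_betw_def)
  have bijJ: "bij_betw ((!) vs) ({..<?n} - I) (set vs - S)"
    by (rule bij_betw_DiffI[OF bij bijI]) (auto simp: I_def S)
  have card: "card I = card S" using bijI by (rule bij_betw_same_card)
  have Isub: "I \<subseteq> {..<?n}" by (auto simp: I_def)
  show le: "card S \<le> ?n" using card_mono[OF _ Isub] card by simp
  have nth: "d ! i = card (parcs G `` {vs ! i})" if "i < ?n" for i
    using vs(3) len that by (auto simp: vertex_degree_eq)
  have "sum ((!) d) I = (\<Sum>i\<in>I. card (parcs G `` {vs ! i}))"
    using Isub nth by (intro sum.cong) auto
  also have "\<dots> = (\<Sum>v\<in>S. card (parcs G `` {v}))"
    by (rule sum.reindex_bij_betw[OF bijI])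
  also have "\<dots> \<le> (\<Sum>v\<in>set vs - S. card (parcs G `` {v}))"
    using S vs(2) sym_arcs by (intro independent_degree_sum_le) (auto simp: symmetric_def dest: wellformed')
  also have "\<dots> = (\<Sum>i\<in>{..<?n} - I. card (parcs G `` {vs ! i}))"
    by (rule sum.reindex_bij_betw[OF bijJ, symmetric])
  also have "\<dots> = sum ((!) d) ({..<?n} - I)"
    using nth by (intro sum.cong) auto
  finally have "2 * sum ((!) d) I \<le> sum ((!) d) {..<?n}"
    using sum.subset_diff[OF Isub, of "(!) d"] by simp
  moreover have "sum ((!) d) {?n - card S..<?n} \<le> sum ((!) d) I"
    unfolding card[symmetric]
  proof (rule sum_final_segment_le[OF _ Isub])
    fix i j assume "i \<le> j" "j < ?n"
    then show "d ! j \<le> d ! i"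
      using assms(3) by (cases "i = j") (auto simp: sorted_wrt_iff_nth_less)
  qed
  moreover have "sum ((!) d) {..<?n} = sum ((!) d) {..<?n - card S} + sum ((!) d) {?n - card S..<?n}"
    by (simp add: lessThan_atLeast0 sum.atLeastLessThan_concat)
  ultimately show "sum ((!) d) {?n - card S..<?n} \<le> sum ((!) d) {..<?n - card S}" by linarith
qed

text \<open>The lower bound: \<open>S\<close> consists of the last \<open>a\<close> vertices in an
  enumeration of \<open>F\<close> matching \<open>d\<close>. From \<open>F\<close> come the vertex
  set and the counting conditions on the degrees; its edges are replaced by those of a new
  forest.\<close>

lemma forest_with_independent_final_segment:
  fixes F :: "'a pair_pre_digraph"
  assumes "undirected_forest F" "has_degree_sequence F d" "a \<le> length d"
    and ann: "sum ((!) d) {length d - a..<length d} \<le> sum ((!) d) {..<length d - a}"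
  shows "\<exists>(G :: 'a pair_pre_digraph) S. G \<in> forests_with d \<and> independent_set G S \<and> card S = a"
proof -
  interpret pair_graph F using assms(1) by (simp add: undirected_forest_def)
  obtain vs where vs: "distinct vs" "set vs = pverts F" "map (vertex_degree F) vs = d"
    using assms(2) unfolding has_degree_sequence_def by blast
  let ?n = "length d"
  define f where "f v = card (parcs F `` {v})" for v
  have len: "length vs = ?n" using vs(3) by auto
  have nth: "d ! i = f (vs ! i)" if "i < ?n" for i
    using vs(3) len that by (auto simp: vertex_degree_eq f_def)
  define S where "S = (!) vs ` {?n - a..<?n}"
  have inj: "inj_on ((!) vs) {..<?n}" using inj_on_nth[OF vs(1)] len by auto
  have V: "pverts F = (!) vs ` {..<?n}" using vs(2) len by (force simp: in_set_conv_nth image_def)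
  have VS: "pverts F - S = (!) vs ` {..<?n - a}"
  proof -
    have "{..<?n} - {?n - a..<?n} = {..<?n - a}" by auto
    moreover have "(!) vs ` ({..<?n} - {?n - a..<?n}) = (!) vs ` {..<?n} - (!) vs ` {?n - a..<?n}"
      by (rule inj_on_image_set_diff[OF inj]) auto
    ultimately show ?thesis unfolding V S_def by simp
  qed
  have SV: "S \<subseteq> pverts F" unfolding S_def V by auto
  have sumimg: "sum f ((!) vs ` X) = sum ((!) d) X" if "X \<subseteq> {..<?n}" for X
    using that nth by (subst sum.reindex) (auto intro!: sum.cong intro: inj_on_subset[OF inj])
  have leS: "sum f S \<le> sum f (pverts F - S)"
    unfolding VS unfolding S_def using ann by (subst (1 2) sumimg) auto
  have sF: "sym (parcs F)" "irrefl (parcs F)" "parcs F \<subseteq> pverts F \<times> pverts F"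
    using sym_arcs no_loops' by (auto simp: symmetric_def irrefl_def dest: wellformed')
  have count: "even (sum f (pverts F))"
    "parcs F \<noteq> {} \<Longrightarrow> sum f (pverts F) + 2 \<le> 2 * card {v \<in> pverts F. f v \<noteq> 0}"
    using forest_degree_sum[OF _ sF(3,1,2) undirected_forest_degenerate1[OF assms(1)]]
    by (auto simp: f_def)
  have "(\<forall>v\<in>pverts F. f v \<le> 1) \<or>
      sum f (pverts F) + 2 \<le> 2 * card {v \<in> pverts F. f v \<noteq> 0}"
    using count(2) by (cases "parcs F = {}") (simp_all add: f_def)
  from forest_realization_with_independent_set[OF pair_finite_verts SV leS count(1) this]
  obtain E where E: "E \<subseteq> pverts F \<times> pverts F" "sym E" "irrefl E" "degenerate1 E"
    and deg: "\<forall>v\<in>pverts F. card (E `` {v}) = f v" and ind: "E \<inter> S \<times> S = {}"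
    by blast
  define G where "G = \<lparr>pverts = pverts F, parcs = E\<rparr>"
  have G: "pair_graph G"
    using E finite_subset[OF E(1)]
    by unfold_locales (auto simp: G_def symmetric_def irrefl_def)
  then have "undirected_forest G"
    unfolding undirected_forest_def using degenerate1_no_cycle[OF G] E(4) by (auto simp: G_def)
  moreover have "map (vertex_degree G) vs = d"
    using vs(2,3) deg by (auto simp: vertex_degree_eq G_def f_def)
  then have "has_degree_sequence G d"
    unfolding has_degree_sequence_def using vs by (intro exI[of _ vs]) (auto simp: G_def)
  moreover have "independent_set G S"
    using SV ind by (auto simp: independent_set_def G_def)
  moreover have "card S = a"
    unfolding S_def using assms(3) by (subst card_image) (auto intro: inj_on_subset[OF inj])
  ultimately show ?thesis unfolding forests_with_def by blast
qed

theorem corollary6: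
  fixes d :: "nat list"
  assumes "d \<noteq> []"
    and "sorted_wrt (\<ge>) d"
    and "\<exists>F :: 'a pair_pre_digraph. undirected_forest F \<and> has_degree_sequence F d"
  shows "alpha_forest_max TYPE('a) d = annihilation_number d"
proof -
  let ?n = "length d"
  define A where "A = {a \<in> {1..?n}. sum ((!) d) {?n - a..<?n} \<le> sum ((!) d) {..<?n - a}}"
  have a: "annihilation_number d = Max A" unfolding annihilation_number_eq A_def ..
  have finA: "finite A" by (simp add: A_def)
  obtain F :: "'a pair_pre_digraph" where F: "undirected_forest F" "has_degree_sequence F d"
    using assms(3) by blast
  \<comment> \<open>The empty set is split off because \<open>A\<close> contains only positive
    numbers.\<close>
  have upper: "card S = 0 \<or> card S \<in> A"
    if "G \<in> forests_with d" "independent_set G S" for G :: "'a pair_pre_digraph" and S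
    using independent_set_annihilates[OF _ _ assms(2) that(2)] that(1)
    by (auto simp: forests_with_def undirected_forest_def A_def)
  \<comment> \<open>A single vertex of \<open>F\<close> is an independent set, and it exists because
    \<open>d\<close> is not empty.\<close>
  have "A \<noteq> {}"
  proof -
    interpret pair_graph F using F(1) by (simp add: undirected_forest_def)
    obtain v where "v \<in> pverts F"
      using F(2) assms(1) unfolding has_degree_sequence_def by (metis list.map_disc_iff last_in_set)
    then have "independent_set F {v}" using no_loops' by (auto simp: independent_set_def)
    then show ?thesis using upper[of F "{v}"] F by (auto simp: forests_with_def)
  qed
  then have "Max A \<in> A" using finA by simp
  then obtain G :: "'a pair_pre_digraph" and S
    where G: "G \<in> forests_with d" "independent_set G S" "card S = Max A"
    using forest_with_independent_final_segment[OF F, of "Max A"] by (auto simp: A_def)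
  have alpha_le: "card S \<le> Max A"
    if "H \<in> forests_with d" "independent_set H S" for H :: "'a pair_pre_digraph" and S
    using upper[OF that] finA by auto
  have fin: "finite {card S |S. independent_set H S}"
    if "H \<in> forests_with d" for H :: "'a pair_pre_digraph"
    by (rule finite_subset[of _ "{..Max A}"]) (use alpha_le[OF that] in auto)
  have le: "independence_number H \<le> Max A"
    if "H \<in> forests_with d" for H :: "'a pair_pre_digraph"
  proof -
    have "independent_set H {}" by (simp add: independent_set_def)
    then show ?thesis
      unfolding independence_number_def using fin[OF that] alpha_le[OF that]
      by (subst Max_le_iff) auto
  qed
  have "Max A \<le> independence_number G"
    unfolding independence_number_def using G by (intro Max_ge[OF fin]) force+
  then have "independence_number G = Max A" using le[OF G(1)] by simp
  \<comment> \<open>Over an infinite vertex type infinitely many forests realize \<open>d\<close>;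
    the bound \<open>Max A\<close> still leaves only finitely many independence numbers, as
    \<open>Max\<close> requires.\<close>
  then show ?thesis
    unfolding a alpha_forest_max_def using G(1) le
    by (intro Max_eqI) (auto intro: finite_subset[of _ "{..Max A}"] exI[of _ G])
qed

end
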